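(* Let $p_1,p_2,\dots,p_r$ be distinct primes, let $k$ and $m$ be positive integers, and let $N\in\eta[p_i]$ with $\gcd(N,k)=1$. Then $$O_N\big(k+\Lambda_{\eta[p_i]}(k)\,m\big)=O_N(k).$$
   Context: $O_N(k)$ is the multiplicative order of $k$ modulo $N$. $\eta[p_i]=\{p_1^{a_1}p_2^{a_2}\cdots p_r^{a_r} : a_i\in\mathbb{Z}_{\ge 0}\}$. $\nu_p(x)$ is the exponent of the prime $p$ in $x$. For a prime $p\nmid k$ and $k>1$, $\gamma_p(k)=\nu_p(k^u-1)$ with $u=O_p(k)$, unless $p=2$ and $k-1$ is twice an odd integer, in which case $\gamma_2(k)=\nu_2(k^2-1)$; if $p$ divides no $k^u-1$ then $\gamma_p(k)=0$. For $k>1$, $\Lambda_{\eta[p_i]}(k)=\prod_{i=1}^r p_i^{\gamma_{p_i}(k)+1}$, and $\Lambda_{\eta[p_i]}(1)=0$. *)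

theory Defs
  imports "HOL-Number_Theory.Number_Theory"
begin

text \<open>
  The multiplicative order of \<open>k\<close> modulo \<open>N\<close> is \<^term>\<open>ord N k\<close>, and the exponent of the prime
  \<open>p\<close> in \<open>x\<close> is \<^term>\<open>multiplicity p x\<close>. The numbers \<open>p\<^sub>1, \<dots>, p\<^sub>r\<close> are the values of a
  function \<open>p\<close> on \<open>{1..r}\<close>; its other values are irrelevant.
\<close>

definition eta :: "nat \<Rightarrow> (nat \<Rightarrow> nat) \<Rightarrow> nat set" where
  "eta r p = {\<Prod>i=1..r. p i ^ a i | a :: nat \<Rightarrow> nat. True}"

text \<open>
  Only meaningful for \<^term>\<open>k > (1::nat)\<close>, so that the subtractions do not truncate. The exponent
  \<open>u\<close> in the first case must be positive, since every number divides \<^term>\<open>k ^ 0 - (1::nat)\<close>.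
\<close>

definition gamma :: "nat \<Rightarrow> nat \<Rightarrow> nat" where
  "gamma q k =
    (if \<not> (\<exists>u>0. q dvd k ^ u - 1) then 0
     else if q = 2 \<and> (\<exists>j. odd j \<and> k - 1 = 2 * j) then multiplicity 2 (k ^ 2 - 1)
     else multiplicity q (k ^ ord q k - 1))"

definition Lambda :: "nat \<Rightarrow> (nat \<Rightarrow> nat) \<Rightarrow> nat \<Rightarrow> nat" where
  "Lambda r p k = (if k = 1 then 0 else (\<Prod>i=1..r. p i ^ (gamma (p i) k + 1)))"

end

theory Submission
  imports Defs
begin

text \<open>
  Let \<open>k'\<close> be the shifted base. By the Chinese remainder theorem it suffices that
  \<open>k ^ d\<close> and \<open>k' ^ d\<close> are congruent to 1 modulo the same powers of each prime \<open>q\<close>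
  dividing \<open>N\<close>. If \<open>q ^ g\<close> is the exact power of \<open>q\<close> in \<open>k ^ u - 1\<close>, where \<open>u\<close> is the
  order of \<open>k\<close> modulo \<open>q\<close> (modulo 4 if \<open>q = 2\<close>), then by lifting the exponent \<open>q ^ a\<close>
  divides \<open>k ^ (u * e) - 1\<close> iff it divides \<open>q ^ g * e\<close>. As \<open>k'\<close> agrees with \<open>k\<close> modulo
  \<open>q ^ (g + 1)\<close>, it has the same \<open>u\<close> and \<open>g\<close>.
\<close>

section \<open>Powers of 1 + b and lifting the exponent\<close>

text \<open>This is the factorisation of \<open>x ^ n - 1\<close> for \<open>x = 1 + b\<close>,
  written without subtraction so that it can be used over the naturals.\<close>

lemma power_eq_one_plus_geometric:
  "(1 + b) ^ n = 1 + b * (\<Sum>i<n. (1 + b) ^ i)" for b :: "'a::comm_semiring_1"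
proof (induction n)
  case 0
  show ?case by simp
next
  case (Suc n)
  have "(1 + b) ^ Suc n = (1 + b) ^ n + b * (1 + b) ^ n"
    by (simp add: algebra_simps)
  also have "\<dots> = 1 + b * (\<Sum>i<n. (1 + b) ^ i) + b * (1 + b) ^ n"
    using Suc by simp
  finally show ?case
    by (simp add: algebra_simps)
qed

text \<open>The binomial expansion cut off after its linear term; it serves to evaluate the
  geometric sum for odd primes.\<close>

lemma cong_power_one_plus:
  "[(1 + b) ^ n = 1 + n * b] (mod b\<^sup>2)" for b :: nat
proof (induction n)
  case 0
  show ?case by simp
next
  case (Suc n)
  have "[(1 + b) * (1 + b) ^ n = (1 + b) * (1 + n * b)] (mod b\<^sup>2)"
    using Suc by (rule cong_scalar_left)
  also have "(1 + b) * (1 + n * b) = (1 + Suc n * b) + n * b\<^sup>2"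
    by (simp add: algebra_simps power2_eq_square)
  also have "[\<dots> = 1 + Suc n * b] (mod b\<^sup>2)"
    by (simp add: cong_def)
  finally show ?case by simp
qed

lemma cong_geometric_sum:
  "[(\<Sum>i<n. (1 + b) ^ i) = n] (mod b)" for b :: nat
proof -
  have "[1 + b = 1 + 0] (mod b)"
    by (intro cong_add) (simp_all add: cong_0_iff)
  then have "[(\<Sum>i<n. (1 + b) ^ i) = (\<Sum>i<n. 1 ^ i)] (mod b)"
    by (intro cong_sum cong_pow) simp
  then show ?thesis by simp
qed

text \<open>The geometric sum that multiplies \<open>q ^ g * s\<close> is congruent to
  \<open>c\<close> modulo \<open>q\<close>, so it contributes no factor \<open>q\<close>.\<close>

lemma power_one_plus_not_dvd:
  fixes q g s c :: nat
  assumes q: "prime q" and s: "\<not> q dvd s" and g: "g > 0" and c: "\<not> q dvd c"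
  shows "\<exists>t. \<not> q dvd t \<and> (1 + q ^ g * s) ^ c = 1 + q ^ g * t"
proof (intro exI conjI)
  let ?S = "\<Sum>i<c. (1 + q ^ g * s) ^ i"
  have "q dvd q ^ g * s"
    using g by simp
  then have "[?S = c] (mod q)"
    by (rule cong_dvd_modulus_nat[OF cong_geometric_sum])
  with c have "\<not> q dvd ?S"
    by (simp add: cong_dvd_iff)
  with q s show "\<not> q dvd s * ?S"
    by (simp add: prime_dvd_mult_iff)
  show "(1 + q ^ g * s) ^ c = 1 + q ^ g * (s * ?S)"
    by (subst power_eq_one_plus_geometric) (simp add: mult.assoc)
qed

text \<open>The geometric sum with \<open>q\<close> terms is congruent to \<open>q\<close> modulo
  \<open>q\<^sup>2\<close>, so it contributes exactly one factor \<open>q\<close>.\<close>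

lemma power_one_plus_prime:
  fixes q g s :: nat
  assumes q: "prime q" and s: "\<not> q dvd s" and g: "g > 0" "q = 2 \<Longrightarrow> g > 1"
  shows "\<exists>t. \<not> q dvd t \<and> (1 + q ^ g * s) ^ q = 1 + q ^ Suc g * t"
proof -
  let ?b = "q ^ g * s"
  have "[(\<Sum>i<q. (1 + ?b) ^ i) = q] (mod q\<^sup>2)"
  proof (cases "q = 2")
    case True
    \<comment> \<open>The sum is \<open>2 + ?b\<close> here, and \<open>g > 1\<close> makes
      \<open>?b\<close> vanish modulo 4.\<close>
    have "4 dvd (2::nat) ^ g"
      using le_imp_power_dvd[of 2 g "2::nat"] g(2)[OF True] by simp
    then have "4 dvd 2 ^ g * s"
      by simp
    then have "[2 + 2 ^ g * s = 2 + 0] (mod 4)"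
      by (intro cong_add) (simp_all add: cong_0_iff)
    moreover have "(\<Sum>i<2. (1 + 2 ^ g * s) ^ i) = 2 + 2 ^ g * s"
      by (simp add: numeral_2_eq_2 lessThan_Suc)
    ultimately show ?thesis
      unfolding True by simp
  next
    case False
    with q have "odd q"
      using primes_dvd_imp_eq two_is_prime_nat by blast
    have qb: "q dvd ?b"
      using g(1) by simp
    have "[(\<Sum>i<q. (1 + ?b) ^ i) = (\<Sum>i<q. 1 + i * ?b)] (mod ?b\<^sup>2)"
      by (intro cong_sum cong_power_one_plus)
    moreover have "q\<^sup>2 dvd ?b\<^sup>2"
      using qb by (rule dvd_power_same)
    ultimately have 1: "[(\<Sum>i<q. (1 + ?b) ^ i) = (\<Sum>i<q. 1 + i * ?b)] (mod q\<^sup>2)"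
      by (rule cong_dvd_modulus_nat)
    have 2: "(\<Sum>i<q. 1 + i * ?b) = q + (\<Sum>i<q. i) * ?b"
      by (simp only: sum_distrib_right sum.distrib) simp
    \<comment> \<open>For odd \<open>q\<close> the triangular number \<open>q * (q - 1) / 2\<close>
      supplies one factor \<open>q\<close>, and \<open>?b\<close> supplies the second.\<close>
    have "(\<Sum>i<q. i) = q * ((q - 1) div 2)"
      using \<open>odd q\<close> by (simp add: Sum_Ico_nat lessThan_atLeast0 div_mult_swap)
    then have "q\<^sup>2 dvd (\<Sum>i<q. i) * ?b"
      using qb by (simp add: power2_eq_square mult_dvd_mono)
    then have "[q + (\<Sum>i<q. i) * ?b = q + 0] (mod q\<^sup>2)"
      by (intro cong_add) (simp_all add: cong_0_iff)
    with 1 show ?thesis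
      unfolding 2 add_0_right by (rule cong_trans)
  qed
  then have S: "[(\<Sum>i<q. (1 + ?b) ^ i) = q] (mod q * q)"
    by (simp only: power2_eq_square)
  then have "[(\<Sum>i<q. (1 + ?b) ^ i) = q] (mod q)"
    by (rule cong_dvd_modulus_nat) simp
  then have "q dvd (\<Sum>i<q. (1 + ?b) ^ i)"
    by (simp only: cong_dvd_iff dvd_refl)
  then obtain t where t: "(\<Sum>i<q. (1 + ?b) ^ i) = q * t" ..
  have "[q * t = q * 1] (mod q * q)"
    using S unfolding t by simp
  then have "q * (t mod q) = q * (1 mod q)"
    unfolding mult_mod_right cong_def .
  then have "[t = 1] (mod q)"
    using q by (simp add: cong_def)
  then have "\<not> q dvd t"
    using q by (metis cong_dvd_iff nat_dvd_1_iff_1 not_prime_1)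
  with q s have "\<not> q dvd s * t"
    by (simp add: prime_dvd_mult_iff)
  moreover have "(1 + ?b) ^ q = 1 + q ^ Suc g * (s * t)"
    using power_eq_one_plus_geometric[of ?b q] unfolding t by (simp only: power_Suc mult_ac)
  ultimately show ?thesis by blast
qed

lemma power_one_plus_prime_power:
  fixes q g s n :: nat
  assumes q: "prime q" and s: "\<not> q dvd s" and g: "g > 0" "q = 2 \<Longrightarrow> g > 1"
  shows "\<exists>t. \<not> q dvd t \<and> (1 + q ^ g * s) ^ (q ^ n) = 1 + q ^ (g + n) * t"
proof (induction n)
  case 0
  show ?case using s by auto
next
  case (Suc n)
  then obtain t where t: "\<not> q dvd t" "(1 + q ^ g * s) ^ (q ^ n) = 1 + q ^ (g + n) * t"
    by blast
  obtain t' where "\<not> q dvd t'" "(1 + q ^ (g + n) * t) ^ q = 1 + q ^ Suc (g + n) * t'"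
    using power_one_plus_prime[OF q t(1), of "g + n"] g by (metis trans_less_add1)
  moreover have "(1 + q ^ g * s) ^ (q ^ Suc n) = ((1 + q ^ g * s) ^ (q ^ n)) ^ q"
    by (simp only: power_Suc2 power_mult)
  ultimately show ?case
    using t(2) by auto
qed

text \<open>Split \<open>e = q ^ n * c\<close> with \<open>c\<close> prime to \<open>q\<close>. The
  power \<open>q ^ n\<close> raises the exact exponent from \<open>g\<close> to \<open>g + n\<close>
  and the power \<open>c\<close> keeps it, so both sides say that \<open>q ^ a\<close> divides
  \<open>q ^ (g + n)\<close>.\<close>

lemma cong_power_one_plus_prime_power_iff:
  fixes q g s e a :: nat
  assumes q: "prime q" and s: "\<not> q dvd s" and g: "g > 0" "q = 2 \<Longrightarrow> g > 1"
  shows "[(1 + q ^ g * s) ^ e = 1] (mod q ^ a) \<longleftrightarrow> q ^ a dvd q ^ g * e"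
proof (cases "e = 0")
  case True
  then show ?thesis by simp
next
  case False
  obtain n c where c: "\<not> q dvd c" and e: "e = q ^ n * c"
    using multiplicity_decompose'[of e q] False q
    by (metis not_prime_unit)
  obtain t where t: "\<not> q dvd t" "(1 + q ^ g * s) ^ (q ^ n) = 1 + q ^ (g + n) * t"
    using power_one_plus_prime_power[OF q s g] by blast
  obtain w where w: "\<not> q dvd w" "(1 + q ^ (g + n) * t) ^ c = 1 + q ^ (g + n) * w"
    using power_one_plus_not_dvd[OF q t(1) _ c, of "g + n"] g(1) by auto
  have cancel: "q ^ a dvd q ^ (g + n) * v \<longleftrightarrow> q ^ a dvd q ^ (g + n)" if "\<not> q dvd v" for v
    using q that by (intro coprime_dvd_mult_left_iff) (simp add: prime_imp_coprime)
  have "(1 + q ^ g * s) ^ e = 1 + q ^ (g + n) * w"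
    unfolding e power_mult t(2) w(2) ..
  then have "[(1 + q ^ g * s) ^ e = 1] (mod q ^ a) \<longleftrightarrow> q ^ a dvd q ^ (g + n) * w"
    by (metis cong_add_lcancel_0_nat cong_0_iff)
  also have "\<dots> \<longleftrightarrow> q ^ a dvd q ^ (g + n) * c"
    using cancel c w(1) by simp
  finally show ?thesis
    by (simp add: e power_add mult.assoc)
qed

section \<open>The exponent \<open>gamma\<close> as a multiplicity\<close>

lemma multiplicity_decompose_plus_one:
  fixes q z g :: nat
  assumes "prime q" "z > 1" "g = multiplicity q (z - 1)"
  shows "\<exists>s. \<not> q dvd s \<and> z = 1 + q ^ g * s"
proof -
  obtain s where "\<not> q dvd s" "z - 1 = q ^ g * s"
    using multiplicity_decompose'[of "z - 1" q] assms
    by (metis not_prime_unit zero_less_diff less_irrefl)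
  then show ?thesis
    using assms(2) by (metis le_add_diff_inverse less_imp_le)
qed

text \<open>
  The order is taken modulo 4 instead of 2 because the lifting step for the prime 2 needs
  a difference divisible by 4; this is why \<^const>\<open>gamma\<close> has its exceptional case.
\<close>

lemma gamma_eq_multiplicity:
  fixes q k :: nat
  assumes q: "prime q" and k: "k > 1" and cop: "coprime q k"
  shows "gamma q k = multiplicity q (k ^ ord (if q = 2 then 4 else q) k - 1)"
proof -
  have "ord q k > 0"
    using cop by (simp add: ord_eq_0)
  moreover have "q dvd k ^ ord q k - 1"
    by (rule cong_to_1_nat[OF ord])
  ultimately have ex: "\<exists>u>0. q dvd k ^ u - 1"
    by blast
  show ?thesis
  proof (cases "q = 2")
    case False
    with ex show ?thesis
      unfolding gamma_def by (simp only: if_False simp_thms)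
  next
    case True
    with cop have "odd k" by simp
    then have ord2: "ord 2 k = 1"
      using ord_divides[of k 1 2] by (simp add: cong_def odd_iff_mod_2_eq_one)
    show ?thesis
    \<comment> \<open>For odd \<open>k\<close>, the exceptional case of \<open>gamma\<close> is
      \<open>k\<close> congruent to 3 modulo 4. There the order modulo 4 is 2, which explains the
      exponent in \<open>k ^ 2 - 1\<close>; otherwise the orders modulo 2 and 4 are both 1.\<close>
    proof (cases "[k = 1] (mod 4)")
      case c1: True
      then have "ord 4 k = 1"
        using ord_divides[of k 1 4] by simp
      moreover have "\<not> (\<exists>j. odd j \<and> k - 1 = 2 * j)"
      proof
        assume "\<exists>j. odd j \<and> k - 1 = 2 * j"
        then obtain j where j: "odd j" "k - 1 = 2 * j" by blast
        have "4 dvd k - 1"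
          using c1 by (rule cong_to_1_nat)
        then have "even j"
          unfolding j(2) by presburger
        with j(1) show False by simp
      qed
      ultimately show ?thesis
        unfolding gamma_def using ex ord2 True by (simp only: if_False if_True simp_thms)
    next
      case c3: False
      have "k mod 4 = 3"
        using \<open>odd k\<close> c3 unfolding cong_def by presburger
      then obtain i where i: "k = 4 * i + 3"
        by (metis mult_div_mod_eq)
      have "[k = 3] (mod 4)"
        using \<open>k mod 4 = 3\<close> by (simp add: cong_def)
      then have "[k\<^sup>2 = 3\<^sup>2] (mod 4)"
        by (rule cong_pow)
      then have "ord 4 k dvd 2"
        by (simp add: ord_divides[symmetric] cong_def)
      moreover have "ord 4 k \<noteq> 1"
        using c3 ord_divides[of k 1 4] by auto
      ultimately have "ord 4 k = 2"
        using two_is_prime_nat unfolding prime_nat_iff by blast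
      moreover have "odd (2 * i + 1)" "k - 1 = 2 * (2 * i + 1)"
        using i by simp_all
      then have "\<exists>j. odd j \<and> k - 1 = 2 * j" by blast
      ultimately show ?thesis
        unfolding gamma_def using ex True by (simp only: if_True if_False simp_thms)
    qed
  qed
qed

section \<open>Changing the base modulo a prime power\<close>

text \<open>For \<open>a\<close> up to \<open>gamma q k + 1\<close> the two bases agree modulo
  \<open>q ^ a\<close>. For larger \<open>a\<close> the modulus \<open>M\<close> of the order
  divides \<open>q ^ a\<close>, and lifting the exponent applies to both bases.\<close>

lemma cong_power_prime_power_iff:
  fixes q k k' a d :: nat
  assumes q: "prime q" and k: "k > 1" and k': "k' > 1" and cop: "coprime q k"
    and kk': "[k' = k] (mod q ^ (gamma q k + 1))"
  shows "[k' ^ d = 1] (mod q ^ a) \<longleftrightarrow> [k ^ d = 1] (mod q ^ a)"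
proof (cases "a \<le> gamma q k + 1")
  case True
  then have "[k' = k] (mod q ^ a)"
    by (rule cong_dvd_modulus_nat[OF kk' le_imp_power_dvd])
  then have "[k' ^ d = k ^ d] (mod q ^ a)"
    by (rule cong_pow)
  then show ?thesis
    by (simp add: cong_def)
next
  case False
  define M where "M = (if q = 2 then 4 else q)"
  define u where "u = ord M k"
  define g where "g = gamma q k"
  have g_eq: "g = multiplicity q (k ^ u - 1)"
    unfolding g_def u_def M_def by (rule gamma_eq_multiplicity[OF q k cop])
  have "coprime M k"
    using cop coprime_power_left_iff[of 2 2 k] by (auto simp: M_def)
  then have u: "u > 0"
    by (simp add: u_def ord_eq_0)
  have ku: "k ^ u > 1" "k' ^ u > 1"
    using k k' u by (intro one_less_power; simp)+
  have "[k ^ u = 1] (mod M)"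
    unfolding u_def by (rule ord)
  then have "M dvd k ^ u - 1"
    by (rule cong_to_1_nat)
  moreover have M_eq: "M = q ^ (if q = 2 then 2 else 1)"
    by (simp add: M_def)
  ultimately have le_g: "(if q = 2 then 2 else 1) \<le> g"
    unfolding g_eq using ku q by (intro multiplicity_geI) auto
  then have g: "g > 0" "q = 2 \<Longrightarrow> g > 1"
    by (auto split: if_splits)
  have "M dvd q ^ (g + 1)"
    unfolding M_eq using le_g by (intro le_imp_power_dvd) simp
  with kk' have "[k' = k] (mod M)"
    unfolding g_def by (rule cong_dvd_modulus_nat)
  then have u': "u = ord M k'"
    unfolding u_def by (rule ord_cong[symmetric])
  have "q ^ (g + 1) dvd q ^ a"
    using False unfolding g_def by (intro le_imp_power_dvd) simp
  with \<open>M dvd q ^ (g + 1)\<close> have Mqa: "M dvd q ^ a"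
    by (rule dvd_trans)
  obtain s where s: "\<not> q dvd s" "k ^ u = 1 + q ^ g * s"
    using multiplicity_decompose_plus_one[OF q ku(1) g_eq] by blast
  have cong_u: "[k' ^ u = 1 + q ^ g * s] (mod q ^ (g + 1))"
    using cong_pow[OF kk', of u] unfolding s(2) g_def .
  then have "[k' ^ u = 1 + q ^ g * s] (mod q ^ g)"
    by (rule cong_dvd_modulus_nat) simp
  also have "[1 + q ^ g * s = 1 + 0] (mod q ^ g)"
    by (intro cong_add) (simp_all add: cong_0_iff)
  finally have "q ^ g dvd k' ^ u - 1"
    by (simp only: add_0_right cong_to_1_nat)
  then obtain s' where "k' ^ u - 1 = q ^ g * s'" ..
  with ku(2) have s'_eq: "k' ^ u = 1 + q ^ g * s'"
    by simp
  \<comment> \<open>The extra factor \<open>q\<close> in the modulus survives cancelling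
    \<open>q ^ g\<close>. Agreement modulo \<open>q ^ g\<close> alone would not exclude that
    \<open>q\<close> divides \<open>s'\<close>.\<close>
  have "[q ^ g * s' = q ^ g * s] (mod q ^ g * q)"
    using cong_u unfolding s'_eq cong_add_lcancel_nat by (simp add: mult.commute)
  then have "[s' = s] (mod q)"
    using q by (simp add: cong_def mult_mod_right[symmetric])
  with s(1) have s': "\<not> q dvd s'"
    by (simp add: cong_dvd_iff)
  show ?thesis
  proof (cases "u dvd d")
    case True
    then obtain e where "d = u * e" ..
    then show ?thesis
      using cong_power_one_plus_prime_power_iff[OF q s(1) g, of e a]
        cong_power_one_plus_prime_power_iff[OF q s' g, of e a]
      by (simp only: power_mult s(2) s'_eq)
  next
    case False
    \<comment> \<open>Both congruences already fail modulo \<open>M\<close>, a divisor of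
      \<open>q ^ a\<close>.\<close>
    have "\<not> [k ^ d = 1] (mod M)" "\<not> [k' ^ d = 1] (mod M)"
      using False unfolding ord_divides by (metis u_def, metis u')
    then show ?thesis
      using cong_dvd_modulus_nat[OF _ Mqa] by blast
  qed
qed

section \<open>Assembling the prime powers\<close>

theorem theorem4:
  fixes p :: "nat \<Rightarrow> nat" and r k m N :: nat
  assumes "inj_on p {1..r}"
    and "\<And>i. i \<in> {1..r} \<Longrightarrow> prime (p i)"
    and "k > 0" and "m > 0"
    and "N \<in> eta r p"
    and "gcd N k = 1"
  shows "ord N (k + Lambda r p k * m) = ord N k"
proof (cases "k = 1")
  case True
  then show ?thesis by (simp add: Lambda_def)
next
  case False
  with assms(3) have k: "k > 1" by simp
  define k' where "k' = k + Lambda r p k * m"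
  obtain a where N: "N = (\<Prod>i=1..r. p i ^ a i)"
    using assms(5) by (auto simp: eta_def)
  have cop: "coprime (p i ^ a i) (p j ^ a j)"
    if "i \<in> {1..r}" "j \<in> {1..r}" "i \<noteq> j" for i j
  proof -
    have "p i \<noteq> p j"
      using assms(1) that by (auto dest: inj_onD)
    then have "coprime (p i) (p j)"
      using assms(2) that by (intro primes_coprime)
    then show ?thesis by simp
  qed
  have prime_power: "[k' ^ d = 1] (mod p i ^ a i) \<longleftrightarrow> [k ^ d = 1] (mod p i ^ a i)"
    if i: "i \<in> {1..r}" for i d
  \<comment> \<open>Coprimality of \<open>p i\<close> and \<open>k\<close> is only available if
    \<open>p i\<close> divides \<open>N\<close>; for exponent 0 the modulus is 1.\<close>
  proof (cases "a i = 0")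
    case True
    then show ?thesis by simp
  next
    case False
    have "p i ^ (gamma (p i) k + 1) dvd Lambda r p k"
      using i k dvd_prodI[of "{1..r}" i "\<lambda>i. p i ^ (gamma (p i) k + 1)"]
      by (simp add: Lambda_def)
    then have "[k' = k + 0] (mod p i ^ (gamma (p i) k + 1))"
      unfolding k'_def by (intro cong_add) (simp_all add: cong_0_iff)
    moreover have "p i dvd N"
      using i False unfolding N by (meson dvd_power dvd_prodI dvd_trans finite_atLeastAtMost neq0_conv)
    then have "coprime (p i) k"
      using assms(6) by (metis coprime_iff_gcd_eq_1 coprime_divisors dvd_refl)
    moreover have "k' > 1"
      using k by (simp add: k'_def)
    ultimately show ?thesis
      using assms(2)[OF i] k by (intro cong_power_prime_power_iff) simp_all
  qed
  have "[x = 1] (mod N) \<longleftrightarrow> (\<forall>i\<in>{1..r}. [x = 1] (mod p i ^ a i))" for x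
  proof (intro iffI ballI)
    fix i assume "[x = 1] (mod N)" "i \<in> {1..r}"
    then show "[x = 1] (mod p i ^ a i)"
      unfolding N by (meson cong_dvd_modulus_nat dvd_prodI finite_atLeastAtMost)
  next
    assume "\<forall>i\<in>{1..r}. [x = 1] (mod p i ^ a i)"
    then show "[x = 1] (mod N)"
      unfolding N by (intro coprime_cong_prod_nat cop) auto
  qed
  then have "[k' ^ d = 1] (mod N) \<longleftrightarrow> [k ^ d = 1] (mod N)" for d
    using prime_power by simp
  \<comment> \<open>An order is determined by its multiples, so no formula for the order modulo a
    product is called for.\<close>
  then have "ord N k' dvd d \<longleftrightarrow> ord N k dvd d" for d
    by (simp only: ord_divides)
  then have "ord N k' = ord N k"
    by (metis dvd_antisym dvd_refl)
  then show ?thesis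
    by (simp add: k'_def)
qed

end
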